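(* For every $\gamma\in[0,1/2]$ and every instance of MP-KHD, let $H$ be the total number of successful assignments (selected and accepted) made by $\mathsf{ATT}(\gamma)$. Then $\mathrm{Var}[H]\le\gamma(1-\gamma)B$, where $B=\sum_{i\in I}b_i$.
   Context: An instance of MP-KHD consists of: a bipartite graph $G=(I,J,E)$ with finite sets $I$ (offline agent types) and $J$ (online agent types); a finite set of prices $\{a_1,\dots,a_K\}$; a capacity $b_i\in\mathbb{Z}_{>0}$ for each $i\in I$; a horizon $T\in\mathbb{Z}_{>0}$; for each $t\in[T]$ a probability distribution $(q_{j,t})_{j\in J}$ on $J$; the assignment set $\mathcal{F}=\{(i,j,k):(i,j)\in E,k\in[K]\}$; for each $f\in\mathcal{F}$, $t\in[T]$, an acceptance probability $p_{f,t}\in(0,1]$ and profit $w_{f,t}\ge0$. $\mathcal{F}_j$ ($\mathcal{F}_i$) is the set of assignments with second (first) coordinate $j$ ($i$). The instance is known in advance. In each round $t$, an online agent type $\hat j_t$ arrives, independently across rounds, with $\Pr[\hat j_t=j]=q_{j,t}$; the policy irrevocably rejects it or selects one $f=(i,\hat j_t,k)\in\mathcal{F}_{\hat j_t}$ with $i$ having remaining capacity; the agent independently accepts with probability $p_{f,t}$ (then $i$'s capacity drops by one and profit $w_{f,t}$ is earned), else nothing happens. The variance is over arrivals, the policy's internal randomness, and acceptance outcomes. Policy $\mathsf{ATT}(\gamma)$, $\gamma\in[0,1/2]$: replace each offline type $i$ by $b_i$ copies of capacity 1 (inheriting $i$'s edges, probabilities and profits), and work with this unit-capacity instance. Solve the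 LP $\max\sum_{t,f}x_{f,t}p_{f,t}w_{f,t}$ s.t. $\sum_{f\in\mathcal{F}_j}x_{f,t}\le q_{j,t}$ for all $j,t$; $\sum_t\sum_{f\in\mathcal{F}_i}x_{f,t}p_{f,t}\le1$ for all $i$; $x\ge0$; let $x$ be an optimal solution. Set $\beta_{i,t}=1-\gamma\sum_{t'<t}\sum_{f\in\mathcal{F}_i}x_{f,t'}p_{f,t'}$. In round $t$, when $j$ arrives, sample at most one assignment, choosing each $f=(i,j,k)\in\mathcal{F}_j$ with probability $\frac{x_{f,t}}{q_{j,t}}\cdot\frac{\gamma}{\beta_{i,t}}$; if some $f=(i,j,k)$ is sampled and $i$ still has its unit of capacity, select $f$; otherwise reject. *)

theory Defs
  imports "HOL-Probability.Probability"
begin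

type_synonym ('i, 'j) assignment = "'i \<times> 'j \<times> nat"

text \<open>Rounds are numbered \<open>1, \<dots>, T\<close> and prices \<open>1, \<dots>, K\<close>. The arrival distribution
  \<open>(q\<^sub>j\<^sub>,\<^sub>t)\<^sub>j\<close> is a probability mass function for each round, so that \<open>q\<^sub>j\<^sub>,\<^sub>t\<close> is
  \<open>pmf (arrival M t) j\<close>. The two sides of the bipartite graph have separate types.\<close>

record ('i, 'j) mpkhd =
  offline :: "'i set"
  online :: "'j set"
  edges :: "('i \<times> 'j) set"
  num_prices :: nat
  price :: "nat \<Rightarrow> real"
  capacity :: "'i \<Rightarrow> nat"
  horizon :: nat
  arrival :: "nat \<Rightarrow> 'j pmf"
  accept_prob :: "('i, 'j) assignment \<Rightarrow> nat \<Rightarrow> real"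
  profit :: "('i, 'j) assignment \<Rightarrow> nat \<Rightarrow> real"

definition assignments :: "('i, 'j) mpkhd \<Rightarrow> ('i, 'j) assignment set" where
  "assignments M = {(i, j, k). (i, j) \<in> edges M \<and> k \<in> {1..num_prices M}}"

definition assignments_offline :: "('i, 'j) mpkhd \<Rightarrow> 'i \<Rightarrow> ('i, 'j) assignment set" where
  "assignments_offline M i = {f \<in> assignments M. fst f = i}"

definition assignments_online :: "('i, 'j) mpkhd \<Rightarrow> 'j \<Rightarrow> ('i, 'j) assignment set" where
  "assignments_online M j = {f \<in> assignments M. fst (snd f) = j}"

definition mpkhd_instance :: "('i, 'j) mpkhd \<Rightarrow> bool" where
  "mpkhd_instance M \<longleftrightarrow>
     finite (offline M) \<and> finite (online M) \<and> edges M \<subseteq> offline M \<times> online M \<and>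
     (\<forall>i \<in> offline M. capacity M i > 0) \<and>
     horizon M > 0 \<and>
     (\<forall>t \<in> {1..horizon M}. set_pmf (arrival M t) \<subseteq> online M) \<and>
     (\<forall>f \<in> assignments M. \<forall>t \<in> {1..horizon M}.
        0 < accept_prob M f t \<and> accept_prob M f t \<le> 1 \<and> 0 \<le> profit M f t)"


section \<open>Policies and the induced process\<close>

text \<open>A history lists, round by round, the arriving type, the selected assignment
  (\<open>None\<close> for a rejection) and whether the selected assignment was accepted.\<close>

type_synonym ('i, 'j) history = "('j \<times> ('i, 'j) assignment option \<times> bool) list"

type_synonym ('i, 'j) policy = "('i, 'j) history \<Rightarrow> 'j \<Rightarrow> ('i, 'j) assignment option pmf"

definition num_successes :: "('i, 'j) history \<Rightarrow> nat" where
  "num_successes h = length (filter (\<lambda>(j, s, a). s \<noteq> None \<and> a) h)"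

definition used :: "('i, 'j) history \<Rightarrow> 'i \<Rightarrow> nat" where
  "used h i = length (filter (\<lambda>(j, s, a). map_option fst s = Some i \<and> a) h)"

text \<open>The distribution of the history of the first \<open>n\<close> rounds.\<close>

primrec run :: "('i, 'j) mpkhd \<Rightarrow> ('i, 'j) policy \<Rightarrow> nat \<Rightarrow> ('i, 'j) history pmf" where
  "run M \<pi> 0 = return_pmf []"
| "run M \<pi> (Suc n) =
     bind_pmf (run M \<pi> n) (\<lambda>h.
     bind_pmf (arrival M (Suc n)) (\<lambda>j.
     bind_pmf (\<pi> h j) (\<lambda>s.
     bind_pmf (case s of None \<Rightarrow> return_pmf False
                       | Some f \<Rightarrow> bernoulli_pmf (accept_prob M f (Suc n))) (\<lambda>a.
     return_pmf (h @ [(j, s, a)])))))"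


section \<open>The attenuation policy\<close>

definition unit_copies :: "('i, 'j) mpkhd \<Rightarrow> ('i \<times> nat, 'j) mpkhd" where
  "unit_copies M =
     \<lparr> offline = {(i, c). i \<in> offline M \<and> c \<in> {1..capacity M i}},
       online = online M,
       edges = {((i, c), j). (i, j) \<in> edges M \<and> c \<in> {1..capacity M i}},
       num_prices = num_prices M,
       price = price M,
       capacity = (\<lambda>_. 1),
       horizon = horizon M,
       arrival = arrival M,
       accept_prob = (\<lambda>((i, c), j, k). accept_prob M (i, j, k)),
       profit = (\<lambda>((i, c), j, k). profit M (i, j, k)) \<rparr>"

text \<open>The linear program below is the one for unit-capacity instances. Only the values
  \<open>x f t\<close> with \<open>f \<in> assignments M\<close> and \<open>1 \<le> t \<le> horizon M\<close> are its variables.\<close>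

definition lp_feasible :: "('i, 'j) mpkhd \<Rightarrow> (('i, 'j) assignment \<Rightarrow> nat \<Rightarrow> real) \<Rightarrow> bool" where
  "lp_feasible M x \<longleftrightarrow>
     (\<forall>j \<in> online M. \<forall>t \<in> {1..horizon M}.
        (\<Sum>f\<in>assignments_online M j. x f t) \<le> pmf (arrival M t) j) \<and>
     (\<forall>i \<in> offline M.
        (\<Sum>t=1..horizon M. \<Sum>f\<in>assignments_offline M i. x f t * accept_prob M f t) \<le> 1) \<and>
     (\<forall>f \<in> assignments M. \<forall>t \<in> {1..horizon M}. 0 \<le> x f t)"

definition lp_value :: "('i, 'j) mpkhd \<Rightarrow> (('i, 'j) assignment \<Rightarrow> nat \<Rightarrow> real) \<Rightarrow> real" where
  "lp_value M x =
     (\<Sum>t=1..horizon M. \<Sum>f\<in>assignments M. x f t * accept_prob M f t * profit M f t)"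

definition lp_optimal :: "('i, 'j) mpkhd \<Rightarrow> (('i, 'j) assignment \<Rightarrow> nat \<Rightarrow> real) \<Rightarrow> bool" where
  "lp_optimal M x \<longleftrightarrow> lp_feasible M x \<and> (\<forall>y. lp_feasible M y \<longrightarrow> lp_value M y \<le> lp_value M x)"

definition att_beta ::
    "('i, 'j) mpkhd \<Rightarrow> real \<Rightarrow> (('i, 'j) assignment \<Rightarrow> nat \<Rightarrow> real) \<Rightarrow> 'i \<Rightarrow> nat \<Rightarrow> real" where
  "att_beta M \<gamma> x i t =
     1 - \<gamma> * (\<Sum>t'\<in>{1..<t}. \<Sum>f\<in>assignments_offline M i. x f t' * accept_prob M f t')"

definition att_prob ::
    "('i, 'j) mpkhd \<Rightarrow> real \<Rightarrow> (('i, 'j) assignment \<Rightarrow> nat \<Rightarrow> real) \<Rightarrow> nat \<Rightarrow> 'j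
      \<Rightarrow> ('i, 'j) assignment \<Rightarrow> real" where
  "att_prob M \<gamma> x t j f =
     x f t / pmf (arrival M t) j * (\<gamma> / att_beta M \<gamma> x (fst f) t)"

definition att_density ::
    "('i, 'j) mpkhd \<Rightarrow> real \<Rightarrow> (('i, 'j) assignment \<Rightarrow> nat \<Rightarrow> real) \<Rightarrow> nat \<Rightarrow> 'j
      \<Rightarrow> ('i, 'j) assignment option \<Rightarrow> real" where
  "att_density M \<gamma> x t j s =
     (case s of
        None \<Rightarrow> 1 - (\<Sum>f\<in>assignments_online M j. att_prob M \<gamma> x t j f)
      | Some f \<Rightarrow> if f \<in> assignments_online M j then att_prob M \<gamma> x t j f else 0)"

definition att_sample ::
    "('i, 'j) mpkhd \<Rightarrow> real \<Rightarrow> (('i, 'j) assignment \<Rightarrow> nat \<Rightarrow> real) \<Rightarrow> nat \<Rightarrow> 'j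
      \<Rightarrow> ('i, 'j) assignment option pmf" where
  "att_sample M \<gamma> x t j = embed_pmf (att_density M \<gamma> x t j)"

definition att_policy ::
    "('i, 'j) mpkhd \<Rightarrow> real \<Rightarrow> (('i, 'j) assignment \<Rightarrow> nat \<Rightarrow> real) \<Rightarrow> ('i, 'j) policy" where
  "att_policy M \<gamma> x h j =
     map_pmf
       (\<lambda>s. case s of
              None \<Rightarrow> None
            | Some f \<Rightarrow> if used h (fst f) < capacity M (fst f) then Some f else None)
       (att_sample M \<gamma> x (Suc (length h)) j)"

definition ATT ::
    "('i, 'j) mpkhd \<Rightarrow> real \<Rightarrow> (('i \<times> nat, 'j) assignment \<Rightarrow> nat \<Rightarrow> real)
      \<Rightarrow> ('i \<times> nat, 'j) history pmf" where
  "ATT M \<gamma> x = run (unit_copies M) (att_policy (unit_copies M) \<gamma> x) (horizon M)"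


section \<open>Well-definedness\<close>

lemma finite_assignments:
  assumes "mpkhd_instance M"
  shows "finite (assignments M)"
proof (rule finite_subset)
  show "assignments M \<subseteq> offline M \<times> online M \<times> {1..num_prices M}"
    using assms by (auto simp: assignments_def mpkhd_instance_def)
  show "finite (offline M \<times> online M \<times> {1..num_prices M})"
    using assms by (auto simp: mpkhd_instance_def)
qed

lemma mpkhd_instance_unit_copies:
  assumes "mpkhd_instance M"
  shows "mpkhd_instance (unit_copies M)"
proof -
  have "{(i, c). i \<in> offline M \<and> c \<in> {1..capacity M i}} = Sigma (offline M) (\<lambda>i. {1..capacity M i})"
    by auto
  then have "finite {(i, c). i \<in> offline M \<and> c \<in> {1..capacity M i}}"
    using assms by (auto simp: mpkhd_instance_def)
  then show ?thesis
    using assms by (fastforce simp: mpkhd_instance_def unit_copies_def assignments_def)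
qed

lemma att_beta_ge:
  assumes M: "mpkhd_instance M" and x: "lp_feasible M x"
    and g: "0 \<le> \<gamma>" and t: "t \<in> {1..horizon M}" and i: "i \<in> offline M"
  shows "1 - \<gamma> \<le> att_beta M \<gamma> x i t"
proof -
  let ?g = "\<lambda>t. \<Sum>f\<in>assignments_offline M i. x f t * accept_prob M f t"
  have "?g s \<ge> 0" if "s \<in> {1..horizon M}" for s
    using M x that
    by (intro sum_nonneg mult_nonneg_nonneg)
      (auto simp: lp_feasible_def mpkhd_instance_def assignments_offline_def less_imp_le)
  then have "(\<Sum>s\<in>{1..<t}. ?g s) \<le> (\<Sum>s=1..horizon M. ?g s)"
    using t by (intro sum_mono2) auto
  also have "\<dots> \<le> 1" using x i by (auto simp: lp_feasible_def)
  finally have "\<gamma> * (\<Sum>s\<in>{1..<t}. ?g s) \<le> \<gamma> * 1"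
    using g by (intro mult_left_mono)
  then show ?thesis by (simp add: att_beta_def)
qed

lemma pmf_att_sample:
  assumes M: "mpkhd_instance M" and x: "lp_feasible M x"
    and g: "0 \<le> \<gamma>" "\<gamma> \<le> 1/2" and t: "t \<in> {1..horizon M}" and j: "j \<in> online M"
  shows "pmf (att_sample M \<gamma> x t j) s = att_density M \<gamma> x t j s"
proof -
  let ?F = "assignments_online M j" and ?p = "att_prob M \<gamma> x t j"
  let ?q = "pmf (arrival M t) j"
  have fin: "finite ?F"
    using finite_assignments[OF M] by (simp add: assignments_online_def)
  have x0: "0 \<le> x f t" if "f \<in> ?F" for f
    using x t that by (auto simp: lp_feasible_def assignments_online_def)
  have beta: "1 - \<gamma> \<le> att_beta M \<gamma> x (fst f) t" if "f \<in> ?F" for f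
    using M that by (intro att_beta_ge[OF M x g(1) t])
      (auto simp: assignments_online_def assignments_def mpkhd_instance_def)
  have p0: "0 \<le> ?p f" if "f \<in> ?F" for f
    using x0[OF that] beta[OF that] g by (auto simp: att_prob_def)
  have p1: "?p f \<le> x f t / ?q" if "f \<in> ?F" for f
  proof -
    have "\<gamma> / att_beta M \<gamma> x (fst f) t \<le> 1"
      using beta[OF that] g by (simp add: divide_le_eq)
    then show ?thesis
      unfolding att_prob_def using x0[OF that] by (intro mult_left_le) auto
  qed
  have "sum ?p ?F \<le> (\<Sum>f\<in>?F. x f t / ?q)"
    by (intro sum_mono p1)
  also have "\<dots> = (\<Sum>f\<in>?F. x f t) / ?q"
    by (simp add: sum_divide_distrib)
  also have "\<dots> \<le> 1"
    using x j t pmf_nonneg[of "arrival M t" j]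
    by (cases "?q = 0") (auto simp: lp_feasible_def divide_le_eq)
  finally have le1: "sum ?p ?F \<le> 1" .
  have nn: "0 \<le> att_density M \<gamma> x t j s" for s
    using p0 le1 by (auto simp: att_density_def split: option.split)
  let ?A = "insert None (Some ` ?F)"
  have "(\<integral>\<^sup>+ s. ennreal (att_density M \<gamma> x t j s) \<partial>count_space UNIV) =
      (\<integral>\<^sup>+ s. ennreal (att_density M \<gamma> x t j s) \<partial>count_space ?A)"
    by (rule nn_integral_count_space_eq)
      (auto simp: att_density_def split: option.splits)
  also have "\<dots> = (\<Sum>s\<in>?A. ennreal (att_density M \<gamma> x t j s))"
    using fin by (intro nn_integral_count_space_finite) auto
  also have "\<dots> = ennreal (\<Sum>s\<in>?A. att_density M \<gamma> x t j s)"
    using nn by (intro sum_ennreal) auto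
  also have "(\<Sum>s\<in>?A. att_density M \<gamma> x t j s) = 1"
    using fin by (subst sum.insert) (auto simp: sum.reindex att_density_def)
  finally show ?thesis
    unfolding att_sample_def using nn by (intro pmf_embed_pmf) auto
qed

end

theory Submission
  imports Defs
begin

text \<open>Let \<open>\<beta>\<^sub>i\<^sub>,\<^sub>t\<close> be the attenuation factor of a unit-capacity agent \<open>i\<close>. The attenuation makes the
  probability that a round uses up \<open>i\<close>, given that \<open>i\<close> is free, equal to
  \<open>r\<^sub>i\<^sub>,\<^sub>t = 1 - \<beta>\<^sub>i\<^sub>,\<^sub>t\<^sub>+\<^sub>1 / \<beta>\<^sub>i\<^sub>,\<^sub>t\<close>, whatever the rest of the history. Hence \<open>i\<close> is free before round
  \<open>t\<close> with probability \<open>\<beta>\<^sub>i\<^sub>,\<^sub>t\<close>. A round uses up at most one agent, so two agents stay free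
  together with conditional probability \<open>1 - r\<^sub>i - r\<^sub>k \<le> (1 - r\<^sub>i) (1 - r\<^sub>k)\<close>; therefore the events of
  being free at the end are pairwise negatively correlated. The variance of the number of
  successes is thus at most the sum of the variances \<open>\<beta> (1 - \<beta>)\<close>, and \<open>1 - \<beta> \<le> \<gamma> \<le> 1 / 2\<close>.\<close>

section \<open>Variance of a sum of pairwise negatively correlated indicators\<close>

lemma (in prob_space) variance_sum_indicators_le:
  assumes fin: "finite I" and A: "\<And>i. i \<in> I \<Longrightarrow> A i \<in> events"
    and neg: "\<And>i k. i \<in> I \<Longrightarrow> k \<in> I \<Longrightarrow> i \<noteq> k \<Longrightarrow> prob (A i \<inter> A k) \<le> prob (A i) * prob (A k)"
  shows "variance (\<lambda>\<omega>. \<Sum>i\<in>I. indicat_real (A i) \<omega>) \<le> (\<Sum>i\<in>I. prob (A i) * (1 - prob (A i)))"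
proof -
  have int: "integrable M (indicat_real (A i))" if "i \<in> I" for i
    using A[OF that] by (simp add: emeasure_eq_measure)
  have int2: "integrable M (\<lambda>\<omega>. indicat_real (A i) \<omega> * indicat_real (A k) \<omega>)"
    if "i \<in> I" "k \<in> I" for i k
    using A that by (simp add: indicator_inter_arith[symmetric] emeasure_eq_measure)
  have E: "expectation (\<lambda>\<omega>. \<Sum>i\<in>I. indicat_real (A i) \<omega>) = (\<Sum>i\<in>I. prob (A i))"
    using int A by (simp add: Bochner_Integration.integral_sum)
  have E2: "expectation (\<lambda>\<omega>. (\<Sum>i\<in>I. indicat_real (A i) \<omega>)\<^sup>2) = (\<Sum>i\<in>I. \<Sum>k\<in>I. prob (A i \<inter> A k))"
  proof -
    have prod: "expectation (\<lambda>\<omega>. indicat_real (A i) \<omega> * indicat_real (A k) \<omega>) = prob (A i \<inter> A k)"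
      if "i \<in> I" "k \<in> I" for i k
      using A that by (simp add: indicator_inter_arith[symmetric])
    have "expectation (\<lambda>\<omega>. (\<Sum>i\<in>I. indicat_real (A i) \<omega>)\<^sup>2)
        = (\<Sum>i\<in>I. \<Sum>k\<in>I. expectation (\<lambda>\<omega>. indicat_real (A i) \<omega> * indicat_real (A k) \<omega>))"
      using int2 by (simp add: power2_eq_square sum_product)
    also have "\<dots> = (\<Sum>i\<in>I. \<Sum>k\<in>I. prob (A i \<inter> A k))"
      by (intro sum.cong refl prod)
    finally show ?thesis .
  qed
  have "variance (\<lambda>\<omega>. \<Sum>i\<in>I. indicat_real (A i) \<omega>)
      = (\<Sum>i\<in>I. \<Sum>k\<in>I. prob (A i \<inter> A k)) - (\<Sum>i\<in>I. prob (A i))\<^sup>2"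
    unfolding E2[symmetric] E[symmetric] using int int2
    by (intro variance_eq) (auto simp: power2_eq_square sum_product)
  also have "\<dots> = (\<Sum>i\<in>I. \<Sum>k\<in>I. prob (A i \<inter> A k) - prob (A i) * prob (A k))"
    by (simp add: power2_eq_square sum_product sum_subtractf)
  \<comment> \<open>The double sum consists of covariances. Those off the diagonal are at most 0 by
    \<open>neg\<close>; on the diagonal \<open>A i \<inter> A i = A i\<close> leaves the variance of
    a single indicator.\<close>
  also have "\<dots> \<le> (\<Sum>i\<in>I. \<Sum>k\<in>I. if i = k then prob (A i) * (1 - prob (A i)) else 0)"
    using neg by (intro sum_mono) (auto simp: algebra_simps)
  also have "\<dots> = (\<Sum>i\<in>I. prob (A i) * (1 - prob (A i)))"
    using fin by simp
  finally show ?thesis .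
qed

lemma measure_bind_pmf:
  "measure_pmf.prob (bind_pmf p f) X = measure_pmf.expectation p (\<lambda>y. measure_pmf.prob (f y) X)"
  unfolding measure_pmf_bind
  by (rule measure_pmf.measure_bind[where N = "count_space UNIV"])
    (auto simp: measure_subprob)

section \<open>A single round\<close>

abbreviation outcome ::
    "('i, 'j) mpkhd \<Rightarrow> nat \<Rightarrow> ('i, 'j) assignment option \<Rightarrow> bool pmf" where
  "outcome N t s \<equiv> (case s of None \<Rightarrow> return_pmf False
                             | Some f \<Rightarrow> bernoulli_pmf (accept_prob N f t))"

text \<open>Taking a set of agents lets one recursion serve both the marginals (singletons) and the
  correlations (pairs).\<close>

definition all_free :: "'i set \<Rightarrow> ('i, 'j) history set" where
  "all_free S = {h. \<forall>i\<in>S. used h i = 0}"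

text \<open>The decrease of \<open>att_beta\<close> over round \<open>t\<close> relative to its
  value at \<open>t\<close>. No arrival probability occurs, because it cancels against the division
  in \<open>att_prob\<close>.\<close>

definition use_rate ::
    "('i, 'j) mpkhd \<Rightarrow> real \<Rightarrow> (('i, 'j) assignment \<Rightarrow> nat \<Rightarrow> real) \<Rightarrow> 'i \<Rightarrow> nat \<Rightarrow> real" where
  "use_rate N \<gamma> x i t =
     \<gamma> * (\<Sum>f\<in>assignments_offline N i. x f t * accept_prob N f t) / att_beta N \<gamma> x i t"

lemma used_append: "used (h @ g) i = used h i + used g i"
  by (simp add: used_def)

lemma num_successes_append: "num_successes (h @ g) = num_successes h + num_successes g"
  by (simp add: num_successes_def)

lemma all_free_append: "h @ g \<in> all_free S \<longleftrightarrow> h \<in> all_free S \<and> g \<in> all_free S"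
  by (auto simp: all_free_def used_append)

lemma all_free_single:
  "[(j, s, a)] \<in> all_free S \<longleftrightarrow> (case s of None \<Rightarrow> True | Some f \<Rightarrow> fst f \<in> S \<longrightarrow> \<not> a)"
  by (auto simp: all_free_def used_def split: option.splits)

lemma length_run: "h \<in> set_pmf (run M \<pi> n) \<Longrightarrow> length h = n"
  by (induction n arbitrary: h) auto

lemma set_pmf_att_sample:
  assumes "mpkhd_instance N" "lp_feasible N x" "0 \<le> \<gamma>" "\<gamma> \<le> 1/2"
    and "t \<in> {1..horizon N}" "j \<in> online N"
  shows "set_pmf (att_sample N \<gamma> x t j) \<subseteq> insert None (Some ` assignments_online N j)"
  by (auto simp: set_pmf_iff pmf_att_sample[OF assms] att_density_def
      split: option.splits if_splits)

locale unit_att =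
  fixes N :: "('i, 'j) mpkhd" and \<gamma> :: real and x :: "('i, 'j) assignment \<Rightarrow> nat \<Rightarrow> real"
  assumes inst: "mpkhd_instance N" and feas: "lp_feasible N x"
    and g0: "0 \<le> \<gamma>" and g1: "\<gamma> \<le> 1/2"
    and unit: "\<And>i. i \<in> offline N \<Longrightarrow> capacity N i = 1"
begin

abbreviation "\<beta> \<equiv> att_beta N \<gamma> x"
abbreviation "rate \<equiv> use_rate N \<gamma> x"
abbreviation "\<pi> \<equiv> att_policy N \<gamma> x"

section \<open>Attenuation factors, and survival of a set of agents through one round\<close>

lemma finite_online: "finite (assignments_online N j)"
  using finite_assignments[OF inst] by (simp add: assignments_online_def)

lemma assignment_offline: "f \<in> assignments N \<Longrightarrow> fst f \<in> offline N"
  using inst by (auto simp: assignments_def mpkhd_instance_def)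

lemma assignment_online: "f \<in> assignments N \<Longrightarrow> fst (snd f) \<in> online N"
  using inst by (auto simp: assignments_def mpkhd_instance_def)

text \<open>Extends \<open>att_beta_ge\<close> by the index \<open>Suc (horizon N)\<close>, at which
  the factor is the probability of being free after the last round. There the sum runs over all
  rounds and is bounded by the LP constraint of \<open>i\<close>.\<close>

lemma beta_ge:
  assumes "t \<in> {1..Suc (horizon N)}" "i \<in> offline N"
  shows "1 - \<gamma> \<le> \<beta> i t"
proof (cases "t = Suc (horizon N)")
  case True
  have "\<gamma> * (\<Sum>t=1..horizon N. \<Sum>f\<in>assignments_offline N i. x f t * accept_prob N f t) \<le> \<gamma> * 1"
    using feas assms g0 by (intro mult_left_mono) (auto simp: lp_feasible_def)
  then show ?thesis
    by (simp add: True att_beta_def atLeastLessThanSuc_atLeastAtMost)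
next
  case False
  then show ?thesis using att_beta_ge[OF inst feas g0] assms by auto
qed

lemma beta_Suc:
  assumes "t \<in> {1..horizon N}" "i \<in> offline N"
  shows "\<beta> i (Suc t) = \<beta> i t * (1 - rate i t)"
proof -
  have "\<beta> i t > 0" using beta_ge[of t i] assms g1 by auto
  moreover have "\<beta> i (Suc t)
      = \<beta> i t - \<gamma> * (\<Sum>f\<in>assignments_offline N i. x f t * accept_prob N f t)"
    using assms by (simp add: att_beta_def algebra_simps)
  ultimately show ?thesis by (simp add: use_rate_def right_diff_distrib)
qed

lemma rate_nonneg:
  assumes "t \<in> {1..horizon N}" "i \<in> offline N"
  shows "0 \<le> rate i t"
proof -
  have "\<beta> i t > 0" using beta_ge[of t i] assms g1 by auto
  moreover have "0 \<le> (\<Sum>f\<in>assignments_offline N i. x f t * accept_prob N f t)"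
    using inst feas assms
    by (intro sum_nonneg mult_nonneg_nonneg)
      (auto simp: lp_feasible_def mpkhd_instance_def assignments_offline_def less_imp_le)
  ultimately show ?thesis using g0 by (simp add: use_rate_def)
qed

lemma rate_le_1:
  assumes "t \<in> {1..horizon N}" "i \<in> offline N"
  shows "rate i t \<le> 1"
proof -
  have "\<beta> i t > 0" using beta_ge[of t i] assms g1 by auto
  moreover have "\<beta> i (Suc t) \<ge> 0" using beta_ge[of "Suc t" i] assms g1 by auto
  ultimately show ?thesis
    using beta_Suc[OF assms] by (simp add: zero_le_mult_iff)
qed

text \<open>At most one assignment is sampled, so the ways to lose a member of \<open>S\<close> are
  disjoint events and their probabilities add up.\<close>

lemma prob_free_arrival:
  assumes len: "Suc (length h) \<in> {1..horizon N}" and S: "S \<subseteq> offline N"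
    and h: "h \<in> all_free S" and j: "j \<in> online N"
  shows "measure_pmf.expectation (\<pi> h j) (\<lambda>s. measure_pmf.expectation (outcome N (Suc (length h)) s)
           (\<lambda>a. indicat_real (all_free S) (h @ [(j, s, a)])))
       = 1 - (\<Sum>f\<in>{f \<in> assignments_online N j. fst f \<in> S}.
                att_prob N \<gamma> x (Suc (length h)) j f * accept_prob N f (Suc (length h)))"
    (is "?L = 1 - ?R")
proof -
  let ?t = "Suc (length h)" and ?F = "assignments_online N j"
  let ?sel = "\<lambda>s. case s of None \<Rightarrow> None
            | Some f \<Rightarrow> if used h (fst f) < capacity N (fst f) then Some f else None"
  let ?G = "\<lambda>s. measure_pmf.expectation (outcome N ?t s)
           (\<lambda>a. indicat_real (all_free S) (h @ [(j, s, a)]))"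
  have p: "0 \<le> accept_prob N f ?t" "accept_prob N f ?t \<le> 1" if "f \<in> ?F" for f
    using inst len that by (auto simp: mpkhd_instance_def assignments_online_def less_imp_le)
  have G_None: "?G None = 1"
    using h by (simp add: all_free_append all_free_single)
  have G_Some: "?G (?sel (Some f)) = 1 - (if fst f \<in> S then accept_prob N f ?t else 0)"
    if f: "f \<in> ?F" for f
  proof (cases "fst f \<in> S")
    case True
    \<comment> \<open>A free agent has its unit left, so the capacity check of the policy lets
      \<open>f\<close> through. An agent outside \<open>S\<close> may be blocked or not:
      \<open>S\<close> stays free either way.\<close>
    then have "used h (fst f) < capacity N (fst f)"
      using h S by (auto simp: all_free_def unit)
    then show ?thesis using h True p[OF f]
      by (simp add: all_free_append all_free_single integral_bernoulli_pmf indicator_def)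
  next
    case False
    then show ?thesis using h p[OF f]
      by (simp add: all_free_append all_free_single integral_bernoulli_pmf)
  qed
  \<comment> \<open>Moving the capacity check \<open>?sel\<close> into the integrand leaves the
    sampling distribution, whose density is explicit.\<close>
  have "?L = measure_pmf.expectation (att_sample N \<gamma> x ?t j) (\<lambda>s. ?G (?sel s))"
    by (simp add: att_policy_def)
  also have "\<dots> = (\<Sum>s\<in>insert None (Some ` ?F). ?G (?sel s) * pmf (att_sample N \<gamma> x ?t j) s)"
    using set_pmf_att_sample[OF inst feas g0 g1 len j] finite_online
    by (intro integral_measure_pmf_real) auto
  also have "\<dots> = (\<Sum>s\<in>insert None (Some ` ?F). ?G (?sel s) * att_density N \<gamma> x ?t j s)"
    by (simp only: pmf_att_sample[OF inst feas g0 g1 len j])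
  also have "\<dots> = att_density N \<gamma> x ?t j None + (\<Sum>f\<in>?F. ?G (?sel (Some f)) * att_prob N \<gamma> x ?t j f)"
    using finite_online G_None
    by (subst sum.insert) (auto simp: sum.reindex att_density_def intro!: sum.cong)
  also have "\<dots> = 1 - (\<Sum>f\<in>?F. att_prob N \<gamma> x ?t j f)
      + (\<Sum>f\<in>?F. (1 - (if fst f \<in> S then accept_prob N f ?t else 0)) * att_prob N \<gamma> x ?t j f)"
    unfolding att_density_def option.case(1)
    by (intro arg_cong2[where f = "(+)"] sum.cong refl) (simp only: G_Some)
  also have "\<dots> = 1 - (\<Sum>f\<in>?F. if fst f \<in> S then att_prob N \<gamma> x ?t j f * accept_prob N f ?t else 0)"
  proof -
    have "(1 - (if fst f \<in> S then accept_prob N f ?t else 0)) * att_prob N \<gamma> x ?t j f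
        = att_prob N \<gamma> x ?t j f
          - (if fst f \<in> S then att_prob N \<gamma> x ?t j f * accept_prob N f ?t else 0)" for f
      by (simp add: algebra_simps)
    then show ?thesis by (simp add: sum_subtractf)
  qed
  also have "\<dots> = 1 - ?R"
    using finite_online by (simp add: sum.inter_filter)
  finally show ?thesis .
qed

text \<open>A positive arrival probability cancels. If it is 0, the left side vanishes, and the LP
  constraint of \<open>j\<close> forces the nonnegative \<open>x f t\<close> to be 0 as
  well.\<close>

lemma arrival_times_att_prob:
  assumes t: "t \<in> {1..horizon N}" and f: "f \<in> assignments_online N j" and j: "j \<in> online N"
  shows "pmf (arrival N t) j * att_prob N \<gamma> x t j f = x f t * (\<gamma> / \<beta> (fst f) t)"
proof (cases "pmf (arrival N t) j = 0")
  case True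
  have x0: "0 \<le> x f t" if "f \<in> assignments_online N j" for f
    using feas t that by (auto simp: lp_feasible_def assignments_online_def)
  have "(\<Sum>f\<in>assignments_online N j. x f t) \<le> 0"
    using feas t j True unfolding lp_feasible_def by metis
  then have "(\<Sum>f\<in>assignments_online N j. x f t) = 0"
    using x0 by (intro antisym sum_nonneg) auto
  then have "x f t = 0"
    using f x0 finite_online by (simp add: sum_nonneg_eq_0_iff)
  then show ?thesis using True by simp
qed (simp add: att_prob_def)

text \<open>Averaging over arrivals cancels the arrival probabilities. What remains depends on
  \<open>h\<close> only through its length, which makes the recursion over rounds close.\<close>

lemma prob_free_round:
  assumes len: "Suc (length h) \<in> {1..horizon N}" and S: "S \<subseteq> offline N" and h: "h \<in> all_free S"
  shows "measure_pmf.expectation (arrival N (Suc (length h))) (\<lambda>j.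
           measure_pmf.expectation (\<pi> h j) (\<lambda>s. measure_pmf.expectation (outcome N (Suc (length h)) s)
           (\<lambda>a. indicat_real (all_free S) (h @ [(j, s, a)]))))
       = 1 - (\<Sum>i\<in>S. rate i (Suc (length h)))"
    (is "measure_pmf.expectation ?q ?L = _")
proof -
  let ?t = "Suc (length h)"
  let ?r = "\<lambda>f. x f ?t * (\<gamma> / \<beta> (fst f) ?t) * accept_prob N f ?t"
  have finS: "finite S" and finO: "finite (online N)" and supp: "set_pmf ?q \<subseteq> online N"
    using S inst len by (auto simp: mpkhd_instance_def intro: finite_subset)
  have "measure_pmf.expectation ?q ?L = (\<Sum>j\<in>online N. ?L j * pmf ?q j)"
    using finO supp by (intro integral_measure_pmf_real) auto
  also have "\<dots> = (\<Sum>j\<in>online N. pmf ?q j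
      - (\<Sum>f\<in>{f \<in> assignments_online N j. fst f \<in> S}. ?r f))"
  proof (intro sum.cong refl)
    fix j assume j: "j \<in> online N"
    have "pmf ?q j * (\<Sum>f\<in>{f \<in> assignments_online N j. fst f \<in> S}.
            att_prob N \<gamma> x ?t j f * accept_prob N f ?t)
        = (\<Sum>f\<in>{f \<in> assignments_online N j. fst f \<in> S}. ?r f)"
      unfolding sum_distrib_left mult.assoc[symmetric]
      using arrival_times_att_prob[OF len _ j] by (intro sum.cong) auto
    then show "?L j * pmf ?q j = pmf ?q j - (\<Sum>f\<in>{f \<in> assignments_online N j. fst f \<in> S}. ?r f)"
      unfolding prob_free_arrival[OF len S h j] by (simp add: algebra_simps)
  qed
  also have "\<dots> = 1 - (\<Sum>j\<in>online N. \<Sum>f\<in>{f \<in> assignments_online N j. fst f \<in> S}. ?r f)"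
    using sum_pmf_eq_1[OF finO supp] by (simp add: sum_subtractf)
  \<comment> \<open>The assignments with agent in \<open>S\<close>, grouped by online type, are
    merged into one sum and then regrouped by offline agent.\<close>
  also have "(\<Sum>j\<in>online N. \<Sum>f\<in>{f \<in> assignments_online N j. fst f \<in> S}. ?r f)
      = (\<Sum>j\<in>online N. \<Sum>f\<in>{f \<in> {f \<in> assignments N. fst f \<in> S}. fst (snd f) = j}. ?r f)"
    by (intro sum.cong) (auto simp: assignments_online_def)
  also have "\<dots> = (\<Sum>f\<in>{f \<in> assignments N. fst f \<in> S}. ?r f)"
    using finO finite_assignments[OF inst] assignment_online by (intro sum.group) auto
  also have "\<dots> = (\<Sum>i\<in>S. \<Sum>f\<in>{f \<in> {f \<in> assignments N. fst f \<in> S}. fst f = i}. ?r f)"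
    using finS finite_assignments[OF inst] by (intro sum.group[symmetric]) auto
  also have "\<dots> = (\<Sum>i\<in>S. \<Sum>f\<in>assignments_offline N i. ?r f)"
    by (intro sum.cong) (auto simp: assignments_offline_def)
  also have "\<dots> = (\<Sum>i\<in>S. rate i ?t)"
    by (intro sum.cong refl)
      (auto simp: use_rate_def sum_distrib_left sum_divide_distrib assignments_offline_def
        intro!: sum.cong)
  finally show ?thesis .
qed

section \<open>The whole process\<close>

text \<open>A used agent never becomes free again, so histories outside \<open>all_free S\<close>
  contribute 0; on the others the survival factor is constant.\<close>

lemma prob_all_free_Suc:
  assumes n: "Suc n \<le> horizon N" and S: "S \<subseteq> offline N"
  shows "measure_pmf.prob (run N \<pi> (Suc n)) (all_free S)
       = measure_pmf.prob (run N \<pi> n) (all_free S) * (1 - (\<Sum>i\<in>S. rate i (Suc n)))"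
proof -
  let ?f = "indicat_real (all_free S)"
  have "measure_pmf.prob (run N \<pi> (Suc n)) (all_free S) = measure_pmf.expectation (run N \<pi> n) (\<lambda>h.
         measure_pmf.expectation (arrival N (Suc n)) (\<lambda>j.
         measure_pmf.expectation (\<pi> h j) (\<lambda>s. measure_pmf.expectation (outcome N (Suc n) s)
           (\<lambda>a. ?f (h @ [(j, s, a)])))))"
    by (simp add: measure_bind_pmf measure_return_pmf)
  also have "\<dots> = measure_pmf.expectation (run N \<pi> n) (\<lambda>h. ?f h * (1 - (\<Sum>i\<in>S. rate i (Suc n))))"
  proof (intro integral_cong_AE AE_pmfI)
    fix h assume "h \<in> set_pmf (run N \<pi> n)"
    \<comment> \<open>\<open>att_policy\<close> reads the current round off the length of the
      history.\<close>
    then have len: "length h = n" by (rule length_run)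
    show "measure_pmf.expectation (arrival N (Suc n)) (\<lambda>j.
         measure_pmf.expectation (\<pi> h j) (\<lambda>s. measure_pmf.expectation (outcome N (Suc n) s)
           (\<lambda>a. ?f (h @ [(j, s, a)])))) = ?f h * (1 - (\<Sum>i\<in>S. rate i (Suc n)))"
    proof (cases "h \<in> all_free S")
      case True
      then show ?thesis using prob_free_round[OF _ S True, unfolded len] n by simp
    next
      case False
      then show ?thesis by (simp add: all_free_append)
    qed
  qed auto
  also have "\<dots> = measure_pmf.prob (run N \<pi> n) (all_free S) * (1 - (\<Sum>i\<in>S. rate i (Suc n)))"
    by simp
  finally show ?thesis .
qed

lemma prob_free:
  assumes "n \<le> horizon N" "i \<in> offline N"
  shows "measure_pmf.prob (run N \<pi> n) (all_free {i}) = \<beta> i (Suc n)"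
  using assms(1)
proof (induction n)
  case 0
  then show ?case by (simp add: all_free_def used_def att_beta_def)
next
  case (Suc n)
  then show ?case
    using assms(2) by (simp del: run.simps add: prob_all_free_Suc beta_Suc)
qed

lemma prob_free_pair_le:
  assumes "n \<le> horizon N" "i \<in> offline N" "k \<in> offline N" "i \<noteq> k"
  shows "measure_pmf.prob (run N \<pi> n) (all_free {i, k}) \<le> \<beta> i (Suc n) * \<beta> k (Suc n)"
  using assms(1)
proof (induction n)
  case 0
  then show ?case by (simp add: all_free_def used_def att_beta_def)
next
  case (Suc n)
  let ?P = "measure_pmf.prob (run N \<pi> n) (all_free {i, k})"
  let ?r = "rate i (Suc n)" and ?s = "rate k (Suc n)"
  have r: "0 \<le> ?r" "?r \<le> 1" "0 \<le> ?s" "?s \<le> 1"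
    using Suc.prems assms by (auto intro: rate_nonneg rate_le_1)
  have "measure_pmf.prob (run N \<pi> (Suc n)) (all_free {i, k}) = ?P * (1 - ?r - ?s)"
    using Suc.prems assms by (simp del: run.simps add: prob_all_free_Suc algebra_simps)
  \<comment> \<open>The two factors differ by \<open>?r * ?s\<close>. Passing to the product first
    supplies a factor known to be nonnegative, by which the induction hypothesis can be
    multiplied.\<close>
  also have "\<dots> \<le> ?P * ((1 - ?r) * (1 - ?s))"
    using r by (intro mult_left_mono) (auto simp: algebra_simps)
  also have "\<dots> \<le> \<beta> i (Suc n) * \<beta> k (Suc n) * ((1 - ?r) * (1 - ?s))"
    using Suc r by (intro mult_right_mono) auto
  also have "\<dots> = \<beta> i (Suc (Suc n)) * \<beta> k (Suc (Suc n))"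
    using Suc.prems assms by (simp add: beta_Suc)
  finally show ?case .
qed

text \<open>Each success uses one unit of exactly one offline agent, and the policy checks the
  capacity first. This reduces the number of successes to 0-1 variables, one per agent.\<close>

lemma run_successes:
  assumes "n \<le> horizon N" "h \<in> set_pmf (run N \<pi> n)"
  shows "num_successes h = (\<Sum>i\<in>offline N. used h i) \<and> (\<forall>i\<in>offline N. used h i \<le> 1)"
  using assms
proof (induction n arbitrary: h)
  case 0
  then show ?case by (simp add: num_successes_def used_def)
next
  case (Suc n)
  then obtain h' j s a where h': "h' \<in> set_pmf (run N \<pi> n)" and h: "h = h' @ [(j, s, a)]"
    and j: "j \<in> set_pmf (arrival N (Suc n))" and s: "s \<in> set_pmf (\<pi> h' j)"
    by auto
  have IH: "num_successes h' = (\<Sum>i\<in>offline N. used h' i)" "\<forall>i\<in>offline N. used h' i \<le> 1"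
    using Suc.IH[OF _ h'] Suc.prems by auto
  show ?case
  proof (cases "s \<noteq> None \<and> a")
    case False
    then have "used [(j, s, a)] i = 0" "num_successes [(j, s, a)] = 0" for i
      by (auto simp: used_def num_successes_def)
    then show ?thesis using IH by (simp add: h used_append num_successes_append)
  next
    case True
    then obtain f where f: "s = Some f" "a" by auto
    have t: "Suc n \<in> {1..horizon N}" and jo: "j \<in> online N"
      using Suc.prems j inst by (auto simp: mpkhd_instance_def)
    \<comment> \<open>A selected assignment passed the check and lies in the support of the sampler,
      so its agent is counted in the sum over \<open>offline N\<close>.\<close>
    have fs: "Some f \<in> set_pmf (att_sample N \<gamma> x (Suc n) j)"
      and less: "used h' (fst f) < capacity N (fst f)"
      using s f by (auto simp: att_policy_def length_run[OF h'] split: option.splits if_splits)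
    then have fo: "fst f \<in> offline N"
      using set_pmf_att_sample[OF inst feas g0 g1 t jo] assignment_offline
      by (auto simp: assignments_online_def)
    have u: "used [(j, s, a)] i = (if fst f = i then 1 else 0)"
        "num_successes [(j, s, a)] = 1" for i
      using f by (cases f; simp add: used_def num_successes_def)+
    have "finite (offline N)" using inst by (simp add: mpkhd_instance_def)
    then show ?thesis
      using IH less fo unit[OF fo] by (simp add: h used_append num_successes_append u sum.distrib)
  qed
qed

text \<open>The number of successes is the number of agents minus the number \<open>?Z\<close> of
  agents still free, and this reflection preserves the variance.\<close>

lemma variance_successes_le:
  "measure_pmf.variance (run N \<pi> (horizon N)) (\<lambda>h. real (num_successes h))
     \<le> \<gamma> * (1 - \<gamma>) * real (card (offline N))"
proof -
  let ?R = "run N \<pi> (horizon N)" and ?I = "offline N"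
  let ?A = "\<lambda>i. all_free {i} :: ('i, 'j) history set"
  let ?Z = "\<lambda>h. \<Sum>i\<in>?I. indicat_real (?A i) h"
  have H: "real (num_successes h) = real (card ?I) - ?Z h" if "h \<in> set_pmf ?R" for h
  proof -
    have "indicat_real (?A i) h = 1 - real (used h i)" if "i \<in> ?I" for i
      using run_successes[OF order.refl \<open>h \<in> set_pmf ?R\<close>] that
      by (auto simp: all_free_def indicator_def le_Suc_eq)
    then show ?thesis
      using run_successes[OF order.refl that] by (simp add: sum_subtractf)
  qed
  have E: "measure_pmf.expectation ?R (\<lambda>h. real (num_successes h))
      = real (card ?I) - measure_pmf.expectation ?R ?Z"
  proof -
    have "measure_pmf.expectation ?R (\<lambda>h. real (num_successes h))
        = measure_pmf.expectation ?R (\<lambda>h. real (card ?I) - ?Z h)"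
      using H by (intro integral_cong_AE AE_pmfI) auto
    also have "\<dots> = real (card ?I) - measure_pmf.expectation ?R ?Z"
      by (subst Bochner_Integration.integral_diff)
        (auto intro!: Bochner_Integration.integrable_sum simp: measure_pmf.emeasure_eq_measure)
    finally show ?thesis .
  qed
  have "measure_pmf.variance ?R (\<lambda>h. real (num_successes h)) = measure_pmf.variance ?R ?Z"
    unfolding E using H by (intro integral_cong_AE AE_pmfI) (auto simp: power2_commute)
  also have "\<dots> \<le> (\<Sum>i\<in>?I. measure_pmf.prob ?R (?A i) * (1 - measure_pmf.prob ?R (?A i)))"
  proof (rule measure_pmf.variance_sum_indicators_le)
    show "finite ?I" using inst by (simp add: mpkhd_instance_def)
    fix i k assume ik: "i \<in> ?I" "k \<in> ?I" "i \<noteq> k"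
    have "?A i \<inter> ?A k = all_free {i, k}" by (auto simp: all_free_def)
    then show "measure_pmf.prob ?R (?A i \<inter> ?A k) \<le> measure_pmf.prob ?R (?A i) * measure_pmf.prob ?R (?A k)"
      using prob_free_pair_le[OF order.refl ik] ik by (simp add: prob_free)
  qed auto
  also have "\<dots> \<le> (\<Sum>i\<in>?I. \<gamma> * (1 - \<gamma>))"
  proof (rule sum_mono)
    fix i assume i: "i \<in> ?I"
    let ?b = "measure_pmf.prob ?R (?A i)"
    have "1 - \<gamma> \<le> ?b" using beta_ge[of "Suc (horizon N)" i] i by (simp add: prob_free)
    \<comment> \<open>Since \<gamma> \<le> 1/2, also
      \<open>?b \<ge> 1 - \<gamma> \<ge> \<gamma>\<close>, so both factors are nonnegative. The
      product expands to \<open>\<gamma> * (1 - \<gamma>) - ?b * (1 - ?b)\<close>.\<close>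
    then have "0 \<le> (?b - (1 - \<gamma>)) * (?b - \<gamma>)" using g1 by simp
    then show "?b * (1 - ?b) \<le> \<gamma> * (1 - \<gamma>)" by (simp add: algebra_simps)
  qed
  finally show ?thesis by (simp add: mult.commute)
qed

end

theorem theorem2p3:
  fixes M :: "('i, 'j) mpkhd" and \<gamma> :: real
    and x :: "('i \<times> nat, 'j) assignment \<Rightarrow> nat \<Rightarrow> real"
  assumes "mpkhd_instance M"
    and "0 \<le> \<gamma>" and "\<gamma> \<le> 1 / 2"
    and "lp_optimal (unit_copies M) x"
  shows "measure_pmf.variance (ATT M \<gamma> x) (\<lambda>h. real (num_successes h))
           \<le> \<gamma> * (1 - \<gamma>) * real (\<Sum>i\<in>offline M. capacity M i)"
proof -
  interpret unit_att "unit_copies M" \<gamma> x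
  proof
    show "capacity (unit_copies M) i = 1" for i
      by (simp add: unit_copies_def)
  qed (use assms in \<open>auto simp: mpkhd_instance_unit_copies lp_optimal_def\<close>)
  \<comment> \<open>As a dependent sum, the set of copies has the total capacity as its
    cardinality.\<close>
  have "offline (unit_copies M) = Sigma (offline M) (\<lambda>i. {1..capacity M i})"
    by (auto simp: unit_copies_def)
  then have "card (offline (unit_copies M)) = (\<Sum>i\<in>offline M. capacity M i)"
    using assms(1) by (simp add: mpkhd_instance_def)
  moreover have "horizon (unit_copies M) = horizon M"
    by (simp add: unit_copies_def)
  ultimately show ?thesis
    using variance_successes_le by (simp add: ATT_def)
qed

end
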